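(* There exists a bounded operator $N:L^2(D^c,\mu(x)dx)\to L^2(D^c,\mu(x)dx)$ such that $$(N\phi,\chi)_{L^2(D^c,\mu(x)dx)}=\mathcal{C}(\phi,\chi)=\widehat{\mathcal{E}}(u,v)$$ for all $\phi,\chi\in L^2(D^c,\mu(x)dx)$, where $u$ and $v$ are the solutions of the exterior value Dirichlet problem with exterior data $\phi$ and $\chi$, respectively.
   Context: Setting. Let $d\ge 2$ and let $j:(0,\infty)\to(0,\infty)$ be non-increasing with $\int_{\mathbb{R}^d}(1\wedge|x|^2)\,j(|x|)\,dx<\infty$. Put $k(x,y):=j(|x-y|)$. Let $D\subset\mathbb{R}^d$ be a bounded open set whose boundary $\partial D$ has Lebesgue measure zero; $D^c=\mathbb{R}^d\setminus D$. All functions are measurable and identified when equal a.e. For $u,v:\mathbb{R}^d\to\mathbb{R}$ let $$\widehat{\mathcal{E}}(u,v):=\frac12\iint_{(\mathbb{R}^d\times\mathbb{R}^d)\setminus(D^c\times D^c)}(u(x)-u(y))(v(x)-v(y))k(x,y)\,dy\,dx ,$$ $V^{k,2}(D):=\{u:\mathbb{R}^d\to\mathbb{R}:\ u|_D\in L^2(D),\ \widehat{\mathcal{E}}(u,u)<\infty\}$ and $V^{k,2}_D(D):=\{u\in V^{k,2}(D):u=0\text{ a.e. on }D^c\}$. For $x\in D^c$ let $\mu(x):=\int_Dk(x,y)\,dy$. The space $L^2(D^c,\mu(x)dx)$ has inner product $(\phi,\chi)_{L^2(D^c,\mu(x)dx)}=\int_{D^c}\phi(x)\chi(x)\mu(x)\,dx$;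 functions in it are extended to $\mathbb{R}^d$ by $0$ on $D$, and then belong to $V^{k,2}(D)$. Exterior value Dirichlet problem. Given $\phi\in L^2(D^c,\mu(x)dx)$, the solution of $\mathcal{L}u=0$ in $D$, $u=\phi$ on $D^c$ (with $\mathcal{L}u(x)=\mathrm{P.V.}\int_{\mathbb{R}^d}(u(x)-u(y))k(x,y)\,dy$) is the function $u\in V^{k,2}(D)$ such that $u-\phi\in V^{k,2}_D(D)$ and $\widehat{\mathcal{E}}(u,w)=0$ for all $w\in V^{k,2}_D(D)$; it is known to exist and to be unique. The form $\mathcal{C}$ on $L^2(D^c,\mu(x)dx)\times L^2(D^c,\mu(x)dx)$ is defined by $\mathcal{C}(\phi,\chi):=\widehat{\mathcal{E}}(u,v)$, where $u,v$ are the solutions of the exterior value Dirichlet problem with data $\phi,\chi$. "Operator" means linear operator. *)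

theory Defs
  imports "HOL-Analysis.Analysis"
begin

text \<open>
  Conventions. The profile \<open>j\<close> is only relevant on \<open>(0,\<infinity>)\<close>. Measurable functions are represented
  by Borel measurable ones; as functions are identified when equal almost everywhere, this loses
  nothing compared with Lebesgue measurability.
\<close>

definition kernel :: "(real \<Rightarrow> real) \<Rightarrow> real^'n \<Rightarrow> real^'n \<Rightarrow> real" where
  "kernel j x y = j (norm (x - y))"

definition form_domain :: "(real^'n) set \<Rightarrow> ((real^'n) \<times> (real^'n)) set" where
  "form_domain D = UNIV - (- D) \<times> (- D)"

definition form_E ::
    "(real \<Rightarrow> real) \<Rightarrow> (real^'n) set \<Rightarrow> (real^'n \<Rightarrow> real) \<Rightarrow> (real^'n \<Rightarrow> real) \<Rightarrow> real" where
  "form_E j D u v = 1/2 * (LINT (x, y):form_domain D | lborel \<Otimes>\<^sub>M lborel.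
      (u x - u y) * (v x - v y) * kernel j x y)"

text \<open>
  The diagonal value \<open>form_E j D u u\<close> as an element of \<open>[0,\<infinity>]\<close>; it is needed to express its
  finiteness, since the Bochner integral of a non-integrable function is \<open>0\<close>.
\<close>

definition energy :: "(real \<Rightarrow> real) \<Rightarrow> (real^'n) set \<Rightarrow> (real^'n \<Rightarrow> real) \<Rightarrow> ennreal" where
  "energy j D u = 1/2 * (\<integral>\<^sup>+ (x, y)\<in>form_domain D.
      ennreal ((u x - u y)\<^sup>2 * kernel j x y) \<partial>(lborel \<Otimes>\<^sub>M lborel))"

definition V_space :: "(real \<Rightarrow> real) \<Rightarrow> (real^'n) set \<Rightarrow> (real^'n \<Rightarrow> real) set" where
  "V_space j D = {u \<in> borel_measurable borel.
      (\<integral>\<^sup>+ x\<in>D. ennreal ((u x)\<^sup>2) \<partial>lborel) < \<infinity> \<and> energy j D u < \<infinity>}"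

definition V0_space :: "(real \<Rightarrow> real) \<Rightarrow> (real^'n) set \<Rightarrow> (real^'n \<Rightarrow> real) set" where
  "V0_space j D = {u \<in> V_space j D. AE x in lborel. x \<in> - D \<longrightarrow> u x = 0}"

text \<open>
  The weight takes values in \<open>[0,\<infinity>]\<close>, since it may be infinite at points of the boundary of \<open>D\<close>.
\<close>

definition weight :: "(real \<Rightarrow> real) \<Rightarrow> (real^'n) set \<Rightarrow> real^'n \<Rightarrow> ennreal" where
  "weight j D x = (\<integral>\<^sup>+ y\<in>D. ennreal (kernel j x y) \<partial>lborel)"

text \<open>The measure \<open>\<mu>(x)dx\<close> on the complement of \<open>D\<close>, as a measure on the whole space.\<close>

definition ext_measure :: "(real \<Rightarrow> real) \<Rightarrow> (real^'n) set \<Rightarrow> (real^'n) measure" where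
  "ext_measure j D = density lborel (\<lambda>x. weight j D x * indicator (- D) x)"

text \<open>
  Elements of \<open>L\<^sup>2(D\<^sup>c, \<mu>(x)dx)\<close> are represented by functions extended by \<open>0\<close> to \<open>D\<close>. They are not
  quotiented; equality in the space is equality almost everywhere with respect to \<open>ext_measure\<close>.
\<close>

definition L2_ext :: "(real \<Rightarrow> real) \<Rightarrow> (real^'n) set \<Rightarrow> (real^'n \<Rightarrow> real) set" where
  "L2_ext j D = {\<phi> \<in> borel_measurable borel.
      (\<forall>x\<in>D. \<phi> x = 0) \<and> (\<integral>\<^sup>+ x. ennreal ((\<phi> x)\<^sup>2) \<partial>ext_measure j D) < \<infinity>}"

definition L2_inner ::
    "(real \<Rightarrow> real) \<Rightarrow> (real^'n) set \<Rightarrow> (real^'n \<Rightarrow> real) \<Rightarrow> (real^'n \<Rightarrow> real) \<Rightarrow> real" where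
  "L2_inner j D \<phi> \<psi> = (LINT x|ext_measure j D. \<phi> x * \<psi> x)"

definition L2_norm :: "(real \<Rightarrow> real) \<Rightarrow> (real^'n) set \<Rightarrow> (real^'n \<Rightarrow> real) \<Rightarrow> real" where
  "L2_norm j D \<phi> = sqrt (L2_inner j D \<phi> \<phi>)"

text \<open>
  A bounded linear operator on \<open>L\<^sup>2(D\<^sup>c, \<mu>(x)dx)\<close>, given on representatives. The second condition
  says that it is well defined on classes of functions.
\<close>

definition bounded_operator_L2 ::
    "(real \<Rightarrow> real) \<Rightarrow> (real^'n) set \<Rightarrow> ((real^'n \<Rightarrow> real) \<Rightarrow> (real^'n \<Rightarrow> real)) \<Rightarrow> bool" where
  "bounded_operator_L2 j D N \<longleftrightarrow>
     (\<forall>\<phi>\<in>L2_ext j D. N \<phi> \<in> L2_ext j D) \<and>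
     (\<forall>\<phi>\<in>L2_ext j D. \<forall>\<psi>\<in>L2_ext j D.
        (AE x in ext_measure j D. \<phi> x = \<psi> x) \<longrightarrow> (AE x in ext_measure j D. N \<phi> x = N \<psi> x)) \<and>
     (\<forall>\<phi>\<in>L2_ext j D. \<forall>\<psi>\<in>L2_ext j D.
        AE x in ext_measure j D. N (\<lambda>y. \<phi> y + \<psi> y) x = N \<phi> x + N \<psi> x) \<and>
     (\<forall>\<phi>\<in>L2_ext j D. \<forall>c.
        AE x in ext_measure j D. N (\<lambda>y. c * \<phi> y) x = c * N \<phi> x) \<and>
     (\<exists>K. \<forall>\<phi>\<in>L2_ext j D. L2_norm j D (N \<phi>) \<le> K * L2_norm j D \<phi>)"

definition is_dirichlet_solution ::
    "(real \<Rightarrow> real) \<Rightarrow> (real^'n) set \<Rightarrow> (real^'n \<Rightarrow> real) \<Rightarrow> (real^'n \<Rightarrow> real) \<Rightarrow> bool" where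
  "is_dirichlet_solution j D \<phi> u \<longleftrightarrow>
     u \<in> V_space j D \<and> (\<lambda>x. u x - \<phi> x) \<in> V0_space j D \<and>
     (\<forall>w\<in>V0_space j D. form_E j D u w = 0)"

text \<open>Solutions are unique only up to null sets, so a representative is chosen.\<close>

definition dirichlet_solution ::
    "(real \<Rightarrow> real) \<Rightarrow> (real^'n) set \<Rightarrow> (real^'n \<Rightarrow> real) \<Rightarrow> (real^'n \<Rightarrow> real)" where
  "dirichlet_solution j D \<phi> = (SOME u. is_dirichlet_solution j D \<phi> u)"

definition form_C ::
    "(real \<Rightarrow> real) \<Rightarrow> (real^'n) set \<Rightarrow> (real^'n \<Rightarrow> real) \<Rightarrow> (real^'n \<Rightarrow> real) \<Rightarrow> real" where
  "form_C j D \<phi> \<psi> = form_E j D (dirichlet_solution j D \<phi>) (dirichlet_solution j D \<psi>)"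

end

theory Submission
  imports Defs
begin

text \<open>
  Since solutions are tested against functions vanishing outside \<open>D\<close>, \<open>\<E>(u, v)\<close> does not change
  if \<open>v\<close> is replaced by its exterior data \<open>\<psi>\<close>, and Fubini's theorem turns \<open>\<E>(u, \<psi>)\<close> into the
  \<open>L\<^sup>2(D\<^sup>c, \<mu>)\<close> product of \<open>\<psi>\<close> with the explicit function
  \<open>N \<phi> (x) = \<mu>(x)\<^sup>-\<^sup>1 \<integral>\<^sub>D (u(x) - u(y)) k(x, y) dy\<close>; no Riesz representation is needed. By Cauchy-Schwarz
  \<open>\<parallel>N \<phi>\<parallel>\<^sup>2 \<le> 2 \<E>(u, u)\<close>, and \<open>\<E>(u, u) \<le> \<E>(\<phi>, \<phi>) = \<parallel>\<phi>\<parallel>\<^sup>2\<close> because \<open>u\<close> minimizes the energy.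
  Finiteness of \<open>\<mu>\<close> almost everywhere is where the null boundary enters. As the solution is chosen by
  \<open>SOME\<close>, its existence has to be proved; this is done by the direct method.
\<close>

section \<open>Preliminaries: square-integrable functions and increments\<close>

lemma integrable_mult_of_squares:
  fixes f g :: "'a \<Rightarrow> real"
  assumes [measurable]: "f \<in> borel_measurable M" "g \<in> borel_measurable M"
    and "integrable M (\<lambda>x. (f x)\<^sup>2)" "integrable M (\<lambda>x. (g x)\<^sup>2)"
  shows "integrable M (\<lambda>x. f x * g x)"
proof (rule Bochner_Integration.integrable_bound)
  show "integrable M (\<lambda>x. (f x)\<^sup>2 + (g x)\<^sup>2)"
    using assms by auto
  have "\<bar>a * b\<bar> \<le> a\<^sup>2 + b\<^sup>2" for a b :: real
    using sum_squares_bound[of a b] sum_squares_bound[of a "- b"] zero_le_power2[of a] zero_le_power2[of b]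
    by (intro abs_leI; simp)
  then show "AE x in M. norm (f x * g x) \<le> norm ((f x)\<^sup>2 + (g x)\<^sup>2)"
    by (auto intro!: AE_I2)
qed simp

lemma integrable_add_scale_square:
  fixes f g :: "'a \<Rightarrow> real"
  assumes [measurable]: "f \<in> borel_measurable M" "g \<in> borel_measurable M"
    and "integrable M (\<lambda>x. (f x)\<^sup>2)" "integrable M (\<lambda>x. (g x)\<^sup>2)"
  shows "integrable M (\<lambda>x. (f x + c * g x)\<^sup>2)"
proof -
  have "integrable M (\<lambda>x. (f x)\<^sup>2 + (2 * c) * (f x * g x) + c\<^sup>2 * (g x)\<^sup>2)"
    using assms integrable_mult_of_squares[OF assms]
    by (intro Bochner_Integration.integrable_add integrable_mult_right)
  moreover have "(f x)\<^sup>2 + (2 * c) * (f x * g x) + c\<^sup>2 * (g x)\<^sup>2 = (f x + c * g x)\<^sup>2" for x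
    by (simp add: power2_eq_square algebra_simps)
  ultimately show ?thesis by simp
qed

text \<open>Near 0 the linear term dominates, so it cannot have a sign. This turns minimality of the
  energy along a line into the weak equation.\<close>

lemma linear_coefficient_eq_0:
  fixes a b :: real
  assumes "\<And>t. 0 \<le> t * a + t\<^sup>2 * b"
  shows "a = 0"
proof (rule ccontr)
  assume "a \<noteq> 0"
  define s where "s = \<bar>b\<bar> + 1"
  have s: "s > 0" "b \<le> s" by (auto simp: s_def)
  \<comment> \<open>The test value is the minimizer of \<open>t * a + t\<^sup>2 * s\<close>, where
    \<open>s\<close> is a positive upper bound of \<open>b\<close> even when \<open>b\<close> is not
    positive.\<close>
  have "0 \<le> (- a / (2 * s)) * a + (- a / (2 * s))\<^sup>2 * b"
    by (rule assms)
  also have "\<dots> \<le> (- a / (2 * s)) * a + (- a / (2 * s))\<^sup>2 * s"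
    using s by (intro add_left_mono mult_left_mono) auto
  also have "\<dots> = - (a\<^sup>2 / (4 * s))"
    using s by (simp add: field_simps power2_eq_square)
  also have "\<dots> < 0"
    using s \<open>a \<noteq> 0\<close> by simp
  finally show False by simp
qed

definition increment :: "('a \<Rightarrow> real) \<Rightarrow> 'a \<times> 'a \<Rightarrow> real" where
  "increment u p = u (fst p) - u (snd p)"

lemma increment_measurable [measurable]:
  assumes [measurable]: "u \<in> borel_measurable M"
  shows "increment u \<in> borel_measurable (M \<Otimes>\<^sub>M M)"
  unfolding increment_def by measurable

lemma increment_add_scale:
  "increment (\<lambda>x. u x + c * v x) p = increment u p + c * increment v p"
  by (simp add: increment_def algebra_simps)

section \<open>The kernel and the jump measure\<close>

locale jump_form =
  fixes j :: "real \<Rightarrow> real" and D :: "(real^'n) set"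
  assumes j_pos: "\<And>t. t > 0 \<Longrightarrow> j t > 0"
    and j_noninc: "\<And>s t. 0 < s \<Longrightarrow> s \<le> t \<Longrightarrow> j t \<le> j s"
    and D_open: "open D" and D_bounded: "bounded D"
    and D_boundary: "emeasure lborel (frontier D) = 0"
begin

lemma D_measurable [measurable]: "D \<in> sets borel"
  using D_open by simp

text \<open>The value of the kernel on the diagonal is arbitrary in the definitions; it never matters,
  and replacing it by \<open>0\<close> makes the kernel nonnegative.\<close>

definition ker :: "real^'n \<Rightarrow> real^'n \<Rightarrow> real" where
  "ker x y = (if x = y then 0 else j (norm (x - y)))"

lemma ker_nonneg [simp]: "0 \<le> ker x y"
  using j_pos[of "norm (x - y)"] by (auto simp: ker_def)

lemma ker_commute: "ker x y = ker y x"
  by (simp add: ker_def norm_minus_commute)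

lemma ker_measurable [measurable]: "case_prod ker \<in> borel_measurable (borel \<Otimes>\<^sub>M borel)"
proof -
  \<comment> \<open>The sign makes \<open>g\<close> nondecreasing on each of the two half-lines, as
    the rule for piecewise monotone functions requires; the value 0 on the nonpositive half-line
    reproduces the diagonal value of \<open>ker\<close>.\<close>
  define g where "g t = - (if t > 0 then j t else 0)" for t
  have "g \<in> borel_measurable borel"
  proof (rule borel_measurable_piecewise_mono[where C = "{{0<..}, {..0}}"])
    show "mono_on c g" if "c \<in> {{0<..}, {..0}}" for c
      using that j_noninc by (auto simp: mono_on_def g_def)
  qed auto
  then have [measurable]: "(\<lambda>t. - g t) \<in> borel_measurable borel" by simp
  have "ker = (\<lambda>x y. - g (norm (x - y)))"
    by (auto simp: fun_eq_iff ker_def g_def)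
  then show ?thesis by simp
qed

lemma ker_measurable' [measurable (raw)]:
  assumes [measurable]: "f \<in> borel_measurable M" "g \<in> borel_measurable M"
  shows "(\<lambda>x. ker (f x) (g x)) \<in> borel_measurable M"
  using measurable_compose[OF measurable_Pair[OF assms] ker_measurable] by simp

lemma form_domain_measurable [measurable]: "form_domain D \<in> sets (borel \<Otimes>\<^sub>M borel)"
proof -
  have "form_domain D = space (borel \<Otimes>\<^sub>M borel) - (- D) \<times> (- D)"
    by (simp add: form_domain_def space_pair_measure)
  also have "\<dots> \<in> sets (borel \<Otimes>\<^sub>M borel)"
    by (intro sets.Diff sets.top pair_measureI) auto
  finally show ?thesis .
qed

text \<open>Domain of integration and kernel are absorbed into one nonnegative density, so that the
  form becomes half of an L^2 product of increments with respect to \<open>jump_measure\<close>.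
  Integrability and bilinearity then reduce to facts about square-integrable functions.\<close>

definition density_K :: "(real^'n) \<times> (real^'n) \<Rightarrow> real" where
  "density_K p = indicator (form_domain D) p * ker (fst p) (snd p)"

definition jump_measure :: "((real^'n) \<times> (real^'n)) measure" where
  "jump_measure = density (lborel \<Otimes>\<^sub>M lborel) (\<lambda>p. ennreal (density_K p))"

lemma density_K_nonneg [simp]: "0 \<le> density_K p"
  by (simp add: density_K_def)

lemma density_K_measurable [measurable]: "density_K \<in> borel_measurable (borel \<Otimes>\<^sub>M borel)"
  unfolding density_K_def by measurable

lemma sets_jump_measure [measurable_cong]: "sets jump_measure = sets (borel \<Otimes>\<^sub>M borel)"
  unfolding jump_measure_def sets_density by (rule sets_pair_measure_cong) simp_all

lemma kernel_eq_ker: "x \<noteq> y \<Longrightarrow> kernel j x y = ker x y"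
  by (simp add: kernel_def ker_def)

lemma form_E_eq:
  assumes [measurable]: "u \<in> borel_measurable borel" "v \<in> borel_measurable borel"
  shows "form_E j D u v = 1/2 * (LINT p|jump_measure. increment u p * increment v p)"
proof -
  have "(LINT p|jump_measure. increment u p * increment v p) =
      (LINT p|(lborel \<Otimes>\<^sub>M lborel). density_K p *\<^sub>R (increment u p * increment v p))"
    unfolding jump_measure_def by (intro integral_density) auto
  also have "\<dots> = (LINT (x, y):form_domain D | lborel \<Otimes>\<^sub>M lborel.
      (u x - u y) * (v x - v y) * kernel j x y)"
    unfolding set_lebesgue_integral_def
  proof (intro Bochner_Integration.integral_cong refl)
    fix p :: "(real^'n) \<times> (real^'n)"
    obtain x y where p: "p = (x, y)" by (cases p)
    show "density_K p *\<^sub>R (increment u p * increment v p) = indicat_real (form_domain D) p *\<^sub>R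
        (case p of (x, y) \<Rightarrow> (u x - u y) * (v x - v y) * kernel j x y)"
      \<comment> \<open>On the diagonal, the only place where \<open>kernel\<close> and
        \<open>ker\<close> may differ, both increments are 0.\<close>
      by (cases "x = y") (simp_all add: p density_K_def increment_def kernel_eq_ker)
  qed
  finally show ?thesis by (simp add: form_E_def)
qed

lemma nn_integral_jump:
  assumes [measurable]: "f \<in> borel_measurable (borel \<Otimes>\<^sub>M borel)"
  shows "(\<integral>\<^sup>+ p. f p \<partial>jump_measure) =
    (\<integral>\<^sup>+ x. \<integral>\<^sup>+ y. ennreal (density_K (x, y)) * f (x, y) \<partial>lborel \<partial>lborel)"
  unfolding jump_measure_def
  by (subst nn_integral_density) (simp_all add: lborel.nn_integral_fst[symmetric])

lemma energy_eq:
  assumes [measurable]: "u \<in> borel_measurable borel"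
  shows "energy j D u = 1/2 * (\<integral>\<^sup>+ p. ennreal ((increment u p)\<^sup>2) \<partial>jump_measure)"
proof -
  have "(\<integral>\<^sup>+ p. ennreal ((increment u p)\<^sup>2) \<partial>jump_measure) =
      (\<integral>\<^sup>+ p. ennreal (density_K p) * ennreal ((increment u p)\<^sup>2) \<partial>(lborel \<Otimes>\<^sub>M lborel))"
    unfolding jump_measure_def by (intro nn_integral_density) auto
  also have "\<dots> = (\<integral>\<^sup>+ (x, y)\<in>form_domain D.
      ennreal ((u x - u y)\<^sup>2 * kernel j x y) \<partial>(lborel \<Otimes>\<^sub>M lborel))"
  proof (intro nn_integral_cong)
    fix p :: "(real^'n) \<times> (real^'n)"
    obtain x y where p: "p = (x, y)" by (cases p)
    show "ennreal (density_K p) * ennreal ((increment u p)\<^sup>2) =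
        (case p of (x, y) \<Rightarrow> ennreal ((u x - u y)\<^sup>2 * kernel j x y)) * indicator (form_domain D) p"
      by (cases "x = y")
        (auto simp: p density_K_def increment_def kernel_eq_ker ennreal_mult mult_ac split: split_indicator)
  qed
  finally show ?thesis by (simp add: energy_def)
qed

lemma energy_finite_iff:
  assumes [measurable]: "u \<in> borel_measurable borel"
  shows "energy j D u < \<infinity> \<longleftrightarrow> integrable jump_measure (\<lambda>p. (increment u p)\<^sup>2)"
proof -
  have [measurable]: "(\<lambda>p. (increment u p)\<^sup>2) \<in> borel_measurable jump_measure" by measurable
  have "(1/2 :: ennreal) * X < \<infinity> \<longleftrightarrow> X < \<infinity>" for X
  proof -
    have "(1/2 :: ennreal) < top"
      by (simp add: ennreal_divide_eq_top_iff less_top[symmetric])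
    moreover have "(1/2 :: ennreal) \<noteq> 0" by simp
    moreover have "X = 0 \<Longrightarrow> X < top" by simp
    ultimately show ?thesis
      unfolding ennreal_mult_less_top infinity_ennreal_def by blast
  qed
  then show ?thesis
    unfolding energy_eq[OF assms] integrable_iff_bounded by simp
qed

section \<open>The spaces V and V0 and the bilinear form\<close>

lemma V_space_iff:
  "u \<in> V_space j D \<longleftrightarrow> u \<in> borel_measurable borel \<and>
     integrable lborel (\<lambda>x. (indicator D x * u x)\<^sup>2) \<and>
     integrable jump_measure (\<lambda>p. (increment u p)\<^sup>2)"
proof (cases "u \<in> borel_measurable borel")
  case [measurable]: True
  have "(\<integral>\<^sup>+ x\<in>D. ennreal ((u x)\<^sup>2) \<partial>lborel) = (\<integral>\<^sup>+ x. ennreal (norm ((indicator D x * u x)\<^sup>2)) \<partial>lborel)"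
    by (intro nn_integral_cong) (auto split: split_indicator)
  moreover have "(\<lambda>x. (indicator D x * u x)\<^sup>2) \<in> borel_measurable lborel" by measurable
  ultimately show ?thesis
    unfolding V_space_def mem_Collect_eq energy_finite_iff[OF True]
    by (simp only: integrable_iff_bounded[of lborel] True simp_thms)
qed (simp add: V_space_def)

lemma V_space_measurable: "u \<in> V_space j D \<Longrightarrow> u \<in> borel_measurable borel"
  by (simp add: V_space_iff)

text \<open>A single closure rule of the shape \<open>u + c * v\<close> serves for sums, differences
  and perturbations alike. Later functions are written in this shape on purpose, with factors such
  as \<open>1 *\<close> and \<open>(-1) *\<close> left in place.\<close>

lemma V_space_add_scale:
  assumes u: "u \<in> V_space j D" and v: "v \<in> V_space j D"
  shows "(\<lambda>x. u x + c * v x) \<in> V_space j D"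
proof -
  note [measurable] = V_space_measurable[OF u] V_space_measurable[OF v]
  have "integrable lborel (\<lambda>x. (indicator D x * u x + c * (indicator D x * v x))\<^sup>2)"
    using u v by (intro integrable_add_scale_square) (auto simp: V_space_iff)
  moreover have "integrable jump_measure (\<lambda>p. (increment u p + c * increment v p)\<^sup>2)"
    using u v by (intro integrable_add_scale_square) (auto simp: V_space_iff)
  ultimately show ?thesis
    by (simp add: V_space_iff increment_add_scale distrib_left mult.left_commute)
qed

lemma zero_V_space: "(\<lambda>x. 0) \<in> V_space j D"
  by (simp add: V_space_iff increment_def)

lemma V0_space_subset: "w \<in> V0_space j D \<Longrightarrow> w \<in> V_space j D"
  by (simp add: V0_space_def)

lemma V0_space_add_scale:
  assumes "u \<in> V0_space j D" "v \<in> V0_space j D"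
  shows "(\<lambda>x. u x + c * v x) \<in> V0_space j D"
proof -
  have "AE x in lborel. x \<in> - D \<longrightarrow> u x = 0" "AE x in lborel. x \<in> - D \<longrightarrow> v x = 0"
    using assms by (auto simp: V0_space_def)
  then have "AE x in lborel. x \<in> - D \<longrightarrow> u x + c * v x = 0"
    by eventually_elim auto
  then show ?thesis
    using assms V_space_add_scale by (auto simp: V0_space_def)
qed

lemma zero_V0_space: "(\<lambda>x. 0) \<in> V0_space j D"
  by (simp add: V0_space_def zero_V_space)

lemma increment_product_integrable:
  assumes u: "u \<in> V_space j D" and v: "v \<in> V_space j D"
  shows "integrable jump_measure (\<lambda>p. increment u p * increment v p)"
proof -
  note [measurable] = V_space_measurable[OF u] V_space_measurable[OF v]
  show ?thesis
    using u v by (intro integrable_mult_of_squares) (auto simp: V_space_iff)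
qed

lemma form_E_commute: "form_E j D u v = form_E j D v u"
  unfolding form_E_def by (subst mult.commute[of "u _ - u _"]) (rule refl)

lemma form_E_add_scale:
  assumes u: "u \<in> V_space j D" and v: "v \<in> V_space j D" and w: "w \<in> V_space j D"
  shows "form_E j D (\<lambda>x. u x + c * v x) w = form_E j D u w + c * form_E j D v w"
proof -
  note meas = V_space_measurable[OF u] V_space_measurable[OF v] V_space_measurable[OF w]
    V_space_measurable[OF V_space_add_scale[OF u v]]
  show ?thesis
    using increment_product_integrable[OF u w] increment_product_integrable[OF v w]
    unfolding form_E_eq[OF meas(1,3)] form_E_eq[OF meas(2,3)] form_E_eq[OF meas(4,3)]
    by (simp add: increment_add_scale distrib_right mult.assoc)
qed

lemma form_E_add_scale_right:
  assumes "u \<in> V_space j D" "v \<in> V_space j D" "w \<in> V_space j D"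
  shows "form_E j D w (\<lambda>x. u x + c * v x) = form_E j D w u + c * form_E j D w v"
  using form_E_add_scale[OF assms] by (simp only: form_E_commute[of w])

lemma form_E_expand:
  assumes u: "u \<in> V_space j D" and v: "v \<in> V_space j D"
  shows "form_E j D (\<lambda>x. u x + c * v x) (\<lambda>x. u x + c * v x) =
    form_E j D u u + 2 * c * form_E j D u v + c\<^sup>2 * form_E j D v v"
  unfolding form_E_add_scale[OF u v V_space_add_scale[OF u v]]
    form_E_add_scale_right[OF u v u] form_E_add_scale_right[OF u v v] form_E_commute[of v u]
  by (simp add: algebra_simps power2_eq_square)

lemma form_E_nonneg:
  assumes "u \<in> borel_measurable borel"
  shows "0 \<le> form_E j D u u"
  by (simp add: form_E_eq assms integral_nonneg_AE)

lemma nn_integral_increment_square: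
  assumes u: "u \<in> V_space j D"
  shows "(\<integral>\<^sup>+ p. ennreal ((increment u p)\<^sup>2) \<partial>jump_measure) = ennreal (2 * form_E j D u u)"
  unfolding form_E_eq[OF V_space_measurable[OF u] V_space_measurable[OF u]]
  using u by (subst nn_integral_eq_integral) (auto simp: V_space_iff power2_eq_square)

section \<open>The Poincare inequality and existence of solutions\<close>

text \<open>As \<open>D\<close> is bounded, some unit ball lies outside \<open>D\<close> at bounded
  distance from all of its points. There \<open>w\<close> vanishes, so the jumps from
  \<open>D\<close> into that ball, with a kernel bounded below, already control the L^2 norm on
  \<open>D\<close>.\<close>

lemma poincare_inequality:
  obtains \<kappa> where "0 < \<kappa>"
    "\<And>w. w \<in> borel_measurable borel \<Longrightarrow> AE x in lborel. x \<in> - D \<longrightarrow> w x = 0 \<Longrightarrow>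
      ennreal \<kappa> * (\<integral>\<^sup>+ x. ennreal ((indicator D x * w x)\<^sup>2) \<partial>lborel)
        \<le> (\<integral>\<^sup>+ p. ennreal ((increment w p)\<^sup>2) \<partial>jump_measure)"
proof -
  obtain R where R: "R > 0" "\<And>x. x \<in> D \<Longrightarrow> norm x \<le> R"
    using D_bounded by (auto simp: bounded_pos)
  obtain z :: "real^'n" where z: "norm z = R + 1"
    using vector_choose_size[of "R + 1"] R by auto
  \<comment> \<open>Points of \<open>ball z 1\<close> have norm above \<open>R\<close> and at most
    \<open>R + 2\<close>, hence lie outside \<open>D\<close> and within \<open>2 * R + 2\<close> of
    it; by monotonicity \<open>c\<close> is a lower bound of the kernel.\<close>
  define c where "c = j (2 * R + 2)"
  define b where "b = measure lborel (ball z 1)"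
  have [measurable]: "ball z 1 \<in> sets borel" by simp
  have c: "c > 0" using j_pos R by (simp add: c_def)
  have b: "b > 0" by (simp add: b_def content_ball_pos)
  have eb: "emeasure lborel (ball z 1) = ennreal b"
    unfolding b_def by (rule emeasure_eq_ennreal_measure) (use emeasure_lborel_ball_finite[of z 1] in auto)
  have away: "y \<notin> D \<and> c \<le> ker x y" if "x \<in> D" "y \<in> ball z 1" for x y
  proof -
    have "norm y > R" "norm y \<le> R + 2"
      using that z norm_triangle_ineq2[of z y] norm_triangle_ineq2[of y z]
      by (auto simp: dist_norm norm_minus_commute)
    moreover have "norm (x - y) \<le> norm x + norm y" by (rule norm_triangle_ineq4)
    ultimately show ?thesis
      using R(2)[of x] R(2)[of y] that j_noninc[of "norm (x - y)" "2 * R + 2"]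
      by (auto simp: ker_def c_def)
  qed
  show thesis
  proof (rule that[of "c * b"])
    show "0 < c * b" using b c by simp
    fix w :: "real^'n \<Rightarrow> real"
    assume [measurable]: "w \<in> borel_measurable borel" and w0: "AE x in lborel. x \<in> - D \<longrightarrow> w x = 0"
    have inner: "ennreal ((indicator D x * w x)\<^sup>2) * (ennreal c * ennreal b)
        \<le> (\<integral>\<^sup>+ y. ennreal (density_K (x, y)) * ennreal ((increment w (x, y))\<^sup>2) \<partial>lborel)" for x
    proof -
      have "ennreal ((indicator D x * w x)\<^sup>2) * (ennreal c * ennreal b) =
          ennreal ((indicator D x * w x)\<^sup>2) * (\<integral>\<^sup>+ y. ennreal c * indicator (ball z 1) y \<partial>lborel)"
        by (subst nn_integral_cmult_indicator) (simp_all add: eb)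
      also have "\<dots> = (\<integral>\<^sup>+ y. ennreal ((indicator D x * w x)\<^sup>2) * (ennreal c * indicator (ball z 1) y) \<partial>lborel)"
        by (rule nn_integral_cmult[symmetric]) simp
      also have "\<dots> \<le> (\<integral>\<^sup>+ y. ennreal (density_K (x, y)) * ennreal ((increment w (x, y))\<^sup>2) \<partial>lborel)"
        using w0
      proof (intro nn_integral_mono_AE, eventually_elim)
        fix y assume y: "y \<in> - D \<longrightarrow> w y = 0"
        show "ennreal ((indicator D x * w x)\<^sup>2) * (ennreal c * indicator (ball z 1) y)
            \<le> ennreal (density_K (x, y)) * ennreal ((increment w (x, y))\<^sup>2)"
        proof (cases "x \<in> D \<and> y \<in> ball z 1")
          case True
          then have "w y = 0" "c \<le> density_K (x, y)"
            using away[of x y] y by (auto simp: density_K_def form_domain_def)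
          then show ?thesis
            using True by (auto simp: increment_def mult.commute[of "ennreal c"] mult.commute[of "ennreal (density_K _)"]
                intro!: mult_left_mono ennreal_leI)
        qed auto
      qed
      finally show ?thesis .
    qed
    have "ennreal (c * b) * (\<integral>\<^sup>+ x. ennreal ((indicator D x * w x)\<^sup>2) \<partial>lborel) =
        (\<integral>\<^sup>+ x. ennreal ((indicator D x * w x)\<^sup>2) * (ennreal c * ennreal b) \<partial>lborel)"
      using b c by (subst nn_integral_multc) (auto simp: ennreal_mult mult.commute)
    also have "\<dots> \<le> (\<integral>\<^sup>+ x. \<integral>\<^sup>+ y. ennreal (density_K (x, y)) * ennreal ((increment w (x, y))\<^sup>2) \<partial>lborel \<partial>lborel)"
      by (intro nn_integral_mono inner)
    also have "\<dots> = (\<integral>\<^sup>+ p. ennreal ((increment w p)\<^sup>2) \<partial>jump_measure)"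
      by (subst nn_integral_jump) auto
    finally show "ennreal (c * b) * (\<integral>\<^sup>+ x. ennreal ((indicator D x * w x)\<^sup>2) \<partial>lborel)
        \<le> (\<integral>\<^sup>+ p. ennreal ((increment w p)\<^sup>2) \<partial>jump_measure)" .
  qed
qed

text \<open>Pairs with a coordinate in a null set form a null set of the product, and
  \<open>jump_measure\<close> is absolutely continuous. The possibly nonmeasurable exceptional set
  is first enlarged to a Borel null set. This carries a.e. convergence of functions over to their
  increments.\<close>

lemma AE_jump_measure:
  assumes "AE x in lborel. P x"
  shows "AE p in jump_measure. P (fst p) \<and> P (snd p)"
proof -
  obtain N where N: "N \<in> sets borel" "emeasure lborel N = 0" "{x. \<not> P x} \<subseteq> N"
    using assms by (auto elim!: AE_E)
  have "AE x in lborel. x \<notin> N"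
    using N by (intro AE_not_in) (auto simp: null_sets_def)
  then have "AE x in lborel. AE y in lborel. x \<notin> N \<and> y \<notin> N"
    using \<open>AE x in lborel. x \<notin> N\<close> by (auto elim: eventually_mono)
  moreover have "{p \<in> space (lborel \<Otimes>\<^sub>M lborel). fst p \<notin> N \<and> snd p \<notin> N} \<in> sets (lborel \<Otimes>\<^sub>M lborel)"
    using N(1) by measurable
  ultimately have "AE p in lborel \<Otimes>\<^sub>M lborel. fst p \<notin> N \<and> snd p \<notin> N"
    by (intro lborel_pair.AE_pair_measure) auto
  then have "AE p in lborel \<Otimes>\<^sub>M lborel. 0 < ennreal (density_K p) \<longrightarrow> P (fst p) \<and> P (snd p)"
    by eventually_elim (use N(3) in auto)
  then show ?thesis
    unfolding jump_measure_def by (subst AE_density) auto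
qed

text \<open>The inequality |t| \<le> \<epsilon> + t^2/\<epsilon> is integrated over
  \<open>D\<close>, which has finite measure. The passage to L^1 is made because the subsequence
  converging a.e. is extracted from an L^1 Cauchy sequence.\<close>

lemma L1_bound_on_D:
  assumes [measurable]: "f \<in> borel_measurable borel"
    and int: "integrable lborel (\<lambda>x. (indicat_real D x * f x)\<^sup>2)" and \<epsilon>: "0 < \<epsilon>"
  shows "integrable lborel (\<lambda>x. indicat_real D x * f x)"
    and "(LINT x|lborel. norm (indicat_real D x * f x)) \<le>
      \<epsilon> * measure lborel D + (LINT x|lborel. (indicat_real D x * f x)\<^sup>2) / \<epsilon>"
proof -
  have D: "integrable lborel (indicator D :: _ \<Rightarrow> real)"
    using emeasure_bounded_finite[OF D_bounded] by (intro integrable_real_indicator) auto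
  have bound: "norm (indicat_real D x * f x) \<le> \<epsilon> * indicator D x + (indicat_real D x * f x)\<^sup>2 / \<epsilon>" for x
  proof -
    have "\<bar>t\<bar> \<le> \<epsilon> + t\<^sup>2 / \<epsilon>" for t :: real
    proof -
      have "0 \<le> (\<bar>t\<bar> - \<epsilon>)\<^sup>2 + \<bar>t\<bar> * \<epsilon>" using \<epsilon> by simp
      then have "\<bar>t\<bar> * \<epsilon> \<le> \<epsilon> * \<epsilon> + t\<^sup>2"
        by (simp add: power2_diff power2_eq_square algebra_simps)
      then show ?thesis using \<epsilon> by (simp add: field_simps)
    qed
    then show ?thesis by (simp split: split_indicator)
  qed
  have intb: "integrable lborel (\<lambda>x. \<epsilon> * indicator D x + (indicat_real D x * f x)\<^sup>2 / \<epsilon>)"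
    using D int by auto
  show i: "integrable lborel (\<lambda>x. indicat_real D x * f x)"
  proof (rule Bochner_Integration.integrable_bound[OF intb])
    show "AE x in lborel. norm (indicat_real D x * f x) \<le>
        norm (\<epsilon> * indicator D x + (indicat_real D x * f x)\<^sup>2 / \<epsilon>)"
      by (intro AE_I2 order_trans[OF bound]) simp
  qed simp
  have "(LINT x|lborel. norm (indicat_real D x * f x)) \<le>
      (LINT x|lborel. \<epsilon> * indicator D x + (indicat_real D x * f x)\<^sup>2 / \<epsilon>)"
    by (intro integral_mono intb integrable_norm i bound)
  also have "\<dots> = \<epsilon> * measure lborel D + (LINT x|lborel. (indicat_real D x * f x)\<^sup>2) / \<epsilon>"
    using D int by simp
  finally show "(LINT x|lborel. norm (indicat_real D x * f x)) \<le>
      \<epsilon> * measure lborel D + (LINT x|lborel. (indicat_real D x * f x)\<^sup>2) / \<epsilon>" .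
qed

lemma L1_small_on_D:
  fixes e :: real
  assumes "0 < e"
  obtains d where "0 < d"
    "\<And>f. f \<in> borel_measurable borel \<Longrightarrow> integrable lborel (\<lambda>x. (indicat_real D x * f x)\<^sup>2) \<Longrightarrow>
      (LINT x|lborel. (indicat_real D x * f x)\<^sup>2) < d \<Longrightarrow> (LINT x|lborel. norm (indicat_real D x * f x)) < e"
proof -
  \<comment> \<open>The summand 1 keeps \<open>m\<close> positive when \<open>D\<close> has measure
    0. The choice of \<open>\<epsilon>\<close> bounds the first term of the L^1 estimate by e/2, and
    the threshold \<open>\<epsilon> * (e / 2)\<close> puts the second below e/2.\<close>
  define m where "m = measure lborel D + 1"
  define \<epsilon> where "\<epsilon> = e / (2 * m)"
  have m: "0 < m" "measure lborel D \<le> m" by (simp_all add: m_def add_nonneg_pos)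
  have \<epsilon>: "\<epsilon> > 0" using assms m by (simp add: \<epsilon>_def)
  show thesis
  proof (rule that[of "\<epsilon> * (e / 2)"])
    show "0 < \<epsilon> * (e / 2)" using \<epsilon> assms by simp
    fix f :: "real^'n \<Rightarrow> real"
    assume f: "f \<in> borel_measurable borel" "integrable lborel (\<lambda>x. (indicat_real D x * f x)\<^sup>2)"
      and less: "(LINT x|lborel. (indicat_real D x * f x)\<^sup>2) < \<epsilon> * (e / 2)"
    have "(LINT x|lborel. norm (indicat_real D x * f x)) \<le>
        \<epsilon> * measure lborel D + (LINT x|lborel. (indicat_real D x * f x)\<^sup>2) / \<epsilon>"
      by (rule L1_bound_on_D[OF f \<epsilon>])
    also have "\<dots> < \<epsilon> * m + e / 2"
      using less \<epsilon> m by (intro add_le_less_mono mult_left_mono) (auto simp: pos_divide_less_eq mult.commute)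
    also have "\<dots> = e"
      using m by (simp add: \<epsilon>_def)
    finally show "(LINT x|lborel. norm (indicat_real D x * f x)) < e" .
  qed
qed

text \<open>The solution is the energy minimizer over \<open>\<phi> + V0\<close>. The
  parallelogram identity makes a minimizing sequence Cauchy in energy, the Poincare inequality makes
  it Cauchy in \<open>L\<^sup>1(D)\<close>, and Fatou's lemma shows that an a.e. limit is a minimizer.\<close>

lemma dirichlet_solution_exists:
  assumes \<phi>: "\<phi> \<in> V_space j D"
  shows "\<exists>u. is_dirichlet_solution j D \<phi> u"
proof -
  define Q where "Q s = form_E j D s s" for s
  define S where "S = (\<lambda>w. Q (\<lambda>x. \<phi> x + 1 * w x)) ` V0_space j D"
  have SV: "(\<lambda>x. \<phi> x + 1 * w x) \<in> V_space j D" if "w \<in> V0_space j D" for w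
    using V_space_add_scale[OF \<phi> V0_space_subset[OF that], of 1] .
  have "S \<noteq> {}" using zero_V0_space by (auto simp: S_def)
  have Q_nonneg: "0 \<le> Q s" if "s \<in> V_space j D" for s
    using form_E_nonneg V_space_measurable[OF that] by (simp add: Q_def)
  have bdd: "bdd_below S"
    unfolding S_def using Q_nonneg SV by (intro bdd_belowI[where m = 0]) blast
  have I_le: "Inf S \<le> Q (\<lambda>x. \<phi> x + 1 * w x)" if "w \<in> V0_space j D" for w
    using that by (intro cInf_lower bdd) (auto simp: S_def)
  have "\<exists>w\<in>V0_space j D. Q (\<lambda>x. \<phi> x + 1 * w x) < Inf S + 1 / real (Suc n)" for n
    using cInf_less_iff[OF \<open>S \<noteq> {}\<close> bdd, of "Inf S + 1 / real (Suc n)"] by (auto simp: S_def)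
  then obtain w where w: "\<And>n. w n \<in> V0_space j D"
    and Qw: "\<And>n. Q (\<lambda>x. \<phi> x + 1 * w n x) < Inf S + 1 / real (Suc n)"
    by metis
  have wV: "w n \<in> V_space j D" for n using w V0_space_subset by blast
  note w_meas [measurable] = V_space_measurable[OF wV]
  note \<phi>_meas [measurable] = V_space_measurable[OF \<phi>]

  have cauchy: "Q (\<lambda>x. w n x + (-1) * w m x) \<le> 2 / real (Suc n) + 2 / real (Suc m)" for n m
  proof -
    define a where "a = (\<lambda>x. \<phi> x + 1 * w n x)"
    define d where "d = (\<lambda>x. w n x + (-1) * w m x)"
    have aV: "a \<in> V_space j D" and dV: "d \<in> V_space j D"
      unfolding a_def d_def by (rule SV[OF w], rule V_space_add_scale[OF wV wV])
    have e1: "(\<lambda>x. a x + (-1) * d x) = (\<lambda>x. \<phi> x + 1 * w m x)"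
      by (auto simp: a_def d_def)
    \<comment> \<open>The midpoint \<open>a - d/2\<close> of two competitors is again a competitor,
      so its energy is at least \<open>Inf S\<close>. The claim follows from Q(d) = 2 Q(a) + 2 Q(a -
      d) - 4 Q(a - d/2).\<close>
    have e2: "(\<lambda>x. a x + (-1/2) * d x) = (\<lambda>x. \<phi> x + 1 * (w n x + (-1/2) * d x))"
      by (auto simp: a_def d_def)
    have "(\<lambda>x. w n x + (-1/2) * d x) \<in> V0_space j D"
      unfolding d_def by (intro V0_space_add_scale w)
    then have "Inf S \<le> Q (\<lambda>x. a x + (-1/2) * d x)"
      unfolding e2 by (rule I_le)
    moreover have "Q (\<lambda>x. a x + (-1) * d x) < Inf S + 1 / real (Suc m)" "Q a < Inf S + 1 / real (Suc n)"
      using Qw unfolding e1 by (auto simp: a_def)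
    ultimately have "Q d \<le> 2 / real (Suc n) + 2 / real (Suc m)"
      unfolding Q_def form_E_expand[OF aV dV] by (simp add: power2_eq_square)
    then show ?thesis by (simp add: d_def)
  qed

  obtain \<kappa> where \<kappa>: "0 < \<kappa>" and poincare: "\<And>w. w \<in> borel_measurable borel \<Longrightarrow>
      AE x in lborel. x \<in> - D \<longrightarrow> w x = 0 \<Longrightarrow>
      ennreal \<kappa> * (\<integral>\<^sup>+ x. ennreal ((indicator D x * w x)\<^sup>2) \<partial>lborel)
        \<le> (\<integral>\<^sup>+ p. ennreal ((increment w p)\<^sup>2) \<partial>jump_measure)"
    using poincare_inequality by blast
  have L2: "(LINT x|lborel. (indicator D x * v x)\<^sup>2) \<le> 2 * Q v / \<kappa>" if v: "v \<in> V0_space j D" for v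
  proof -
    have vV: "v \<in> V_space j D" using v by (rule V0_space_subset)
    have "ennreal \<kappa> * ennreal (LINT x|lborel. (indicator D x * v x)\<^sup>2) =
        ennreal \<kappa> * (\<integral>\<^sup>+ x. ennreal ((indicator D x * v x)\<^sup>2) \<partial>lborel)"
      using vV by (subst nn_integral_eq_integral) (auto simp: V_space_iff)
    also have "\<dots> \<le> (\<integral>\<^sup>+ p. ennreal ((increment v p)\<^sup>2) \<partial>jump_measure)"
      using v vV by (intro poincare) (auto simp: V0_space_def V_space_measurable)
    also have "\<dots> = ennreal (2 * Q v)"
      using nn_integral_increment_square[OF vV] by (simp add: Q_def)
    finally have "ennreal (\<kappa> * (LINT x|lborel. (indicator D x * v x)\<^sup>2)) \<le> ennreal (2 * Q v)"
      using \<kappa> by (simp add: ennreal_mult)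
    then have "\<kappa> * (LINT x|lborel. (indicator D x * v x)\<^sup>2) \<le> 2 * Q v"
      using Q_nonneg[OF vV] by (simp add: ennreal_le_iff)
    then show ?thesis using \<kappa> by (simp add: field_simps)
  qed

  have int_w: "integrable lborel (\<lambda>x. indicator D x * w n x)" for n
    using L1_bound_on_D(1)[OF w_meas, of n 1] wV[of n] by (simp add: V_space_iff)
  have L1: "\<exists>N. \<forall>n\<ge>N. \<forall>m\<ge>N. (LINT x|lborel. norm (indicator D x * w n x - indicator D x * w m x)) < e"
    if "0 < e" for e
  proof -
    obtain d where d: "0 < d" and less: "\<And>f. f \<in> borel_measurable borel \<Longrightarrow>
      integrable lborel (\<lambda>x. (indicat_real D x * f x)\<^sup>2) \<Longrightarrow>
      (LINT x|lborel. (indicat_real D x * f x)\<^sup>2) < d \<Longrightarrow>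
      (LINT x|lborel. norm (indicat_real D x * f x)) < e"
      using L1_small_on_D[OF \<open>0 < e\<close>] by blast
    \<comment> \<open>For indices from \<open>N\<close> on the energy of a difference is at most
      4/N, so its squared L^2 norm on \<open>D\<close> is at most 8/(\<kappa> N), which has to be
      below \<open>d\<close>.\<close>
    obtain N :: nat where N: "8 / (\<kappa> * d) < real N"
      using reals_Archimedean2 by blast
    show ?thesis
    proof (intro exI allI impI)
      fix n m assume "N \<le> n" "N \<le> m"
      define f where "f = (\<lambda>x. w n x + (-1) * w m x)"
      have fV0: "f \<in> V0_space j D" unfolding f_def by (intro V0_space_add_scale w)
      then have fV: "f \<in> V_space j D" by (rule V0_space_subset)
      have "0 < 8 / (\<kappa> * d)" using \<kappa> d by simp
      then have "0 < real N" using N by linarith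
      have "2 / real (Suc n) \<le> 2 / real N" "2 / real (Suc m) \<le> 2 / real N"
        using \<open>0 < real N\<close> \<open>N \<le> n\<close> \<open>N \<le> m\<close> by (auto intro!: divide_left_mono)
      then have "2 * Q f / \<kappa> \<le> 2 * (4 / real N) / \<kappa>"
        using cauchy[of n m] \<kappa> by (intro divide_right_mono) (auto simp: f_def)
      also have "\<dots> < d"
        using N \<open>0 < real N\<close> \<kappa> d by (simp add: field_simps)
      finally have "(LINT x|lborel. (indicat_real D x * f x)\<^sup>2) < d"
        using L2[OF fV0] by linarith
      then have "(LINT x|lborel. norm (indicat_real D x * f x)) < e"
        using less fV by (auto simp: V_space_iff)
      then show "(LINT x|lborel. norm (indicator D x * w n x - indicator D x * w m x)) < e"
        by (simp add: f_def right_diff_distrib)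
    qed
  qed
  obtain r where r: "strict_mono r" and "AE x in lborel. Cauchy (\<lambda>i. indicator D x * w (r i) x)"
    using cauchy_L1_AE_cauchy_subseq[OF int_w L1] by blast
  \<comment> \<open>The indicator makes \<open>v\<close> vanish at every point outside
    \<open>D\<close>. The sequence can diverge only on a null set, where the value of
    \<open>lim\<close> is immaterial.\<close>
  define v where "v x = lim (\<lambda>i. indicator D x * w (r i) x)" for x
  have v_meas [measurable]: "v \<in> borel_measurable borel"
    unfolding v_def by measurable
  have v0: "v x = 0" if "x \<notin> D" for x
    using that by (simp add: v_def)
  have "AE x in lborel. \<forall>i. x \<in> - D \<longrightarrow> w (r i) x = 0"
    using w by (intro AE_all_countable[THEN iffD2] allI) (auto simp: V0_space_def)
  with \<open>AE x in lborel. Cauchy _\<close> have conv: "AE x in lborel. (\<lambda>i. w (r i) x) \<longlonglongrightarrow> v x"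
  proof eventually_elim
    fix x assume "Cauchy (\<lambda>i. indicator D x * w (r i) x)" and off: "\<forall>i. x \<in> - D \<longrightarrow> w (r i) x = 0"
    then have "(\<lambda>i. indicator D x * w (r i) x) \<longlonglongrightarrow> v x"
      unfolding v_def by (simp add: Cauchy_convergent_iff convergent_LIMSEQ_iff)
    moreover have "indicator D x * w (r i) x = w (r i) x" for i
      using off by (auto split: split_indicator)
    ultimately show "(\<lambda>i. w (r i) x) \<longlonglongrightarrow> v x" by simp
  qed

  define u where "u = (\<lambda>x. \<phi> x + 1 * v x)"
  have u_meas [measurable]: "u \<in> borel_measurable borel" by (simp add: u_def)
  have "(\<integral>\<^sup>+ p. ennreal ((increment u p)\<^sup>2) \<partial>jump_measure) \<le>
      (\<integral>\<^sup>+ p. liminf (\<lambda>i. ennreal ((increment (\<lambda>x. \<phi> x + 1 * w (r i) x) p)\<^sup>2)) \<partial>jump_measure)"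
    using AE_jump_measure[OF conv]
  proof (intro nn_integral_mono_AE, eventually_elim)
    fix p assume "(\<lambda>i. w (r i) (fst p)) \<longlonglongrightarrow> v (fst p) \<and> (\<lambda>i. w (r i) (snd p)) \<longlonglongrightarrow> v (snd p)"
    then have "(\<lambda>i. ennreal ((increment (\<lambda>x. \<phi> x + 1 * w (r i) x) p)\<^sup>2)) \<longlonglongrightarrow> ennreal ((increment u p)\<^sup>2)"
      unfolding increment_def u_def by (intro tendsto_ennrealI tendsto_intros) auto
    then show "ennreal ((increment u p)\<^sup>2) \<le> liminf (\<lambda>i. ennreal ((increment (\<lambda>x. \<phi> x + 1 * w (r i) x) p)\<^sup>2))"
      by (intro eq_refl lim_imp_Liminf[symmetric]) simp_all
  qed
  also have "\<dots> \<le> liminf (\<lambda>i. \<integral>\<^sup>+ p. ennreal ((increment (\<lambda>x. \<phi> x + 1 * w (r i) x) p)\<^sup>2) \<partial>jump_measure)"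
    by (intro nn_integral_liminf) measurable
  also have "\<dots> \<le> liminf (\<lambda>i. ennreal (2 * (Inf S + 1 / real (Suc i))))"
  proof (intro Liminf_mono always_eventually allI)
    fix i
    have "1 / real (Suc (r i)) \<le> 1 / real (Suc i)"
      using strict_mono_imp_increasing[OF r, of i] by (intro divide_left_mono) auto
    then have "Q (\<lambda>x. \<phi> x + 1 * w (r i) x) \<le> Inf S + 1 / real (Suc i)"
      using Qw[of "r i"] by linarith
    then show "(\<integral>\<^sup>+ p. ennreal ((increment (\<lambda>x. \<phi> x + 1 * w (r i) x) p)\<^sup>2) \<partial>jump_measure)
        \<le> ennreal (2 * (Inf S + 1 / real (Suc i)))"
      unfolding nn_integral_increment_square[OF SV[OF w]] Q_def[symmetric] by (intro ennreal_leI) simp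
  qed
  also have "\<dots> = ennreal (2 * (Inf S + 0))"
    by (intro lim_imp_Liminf tendsto_ennrealI tendsto_intros LIMSEQ_Suc[OF lim_1_over_n]) simp
  finally have u_energy: "(\<integral>\<^sup>+ p. ennreal ((increment u p)\<^sup>2) \<partial>jump_measure) \<le> ennreal (2 * Inf S)"
    by simp
  then have u_int: "integrable jump_measure (\<lambda>p. (increment u p)\<^sup>2)"
    by (auto simp: integrable_iff_bounded intro: le_less_trans)

  have "integrable jump_measure (\<lambda>p. (increment u p + (-1) * increment \<phi> p)\<^sup>2)"
    using u_int \<phi> by (intro integrable_add_scale_square) (auto simp: V_space_iff)
  then have v_int: "integrable jump_measure (\<lambda>p. (increment v p)\<^sup>2)"
    by (simp add: u_def increment_def algebra_simps)
  \<comment> \<open>Square integrability of \<open>v\<close> on \<open>D\<close> is still open here.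
    The inequality with values in [0,\<infinity>] applies nevertheless and deduces it from the
    finite energy.\<close>
  have "ennreal \<kappa> * (\<integral>\<^sup>+ x. ennreal ((indicator D x * v x)\<^sup>2) \<partial>lborel) < \<infinity>"
    using v_int by (intro le_less_trans[OF poincare]) (auto simp: v0 integrable_iff_bounded)
  then have "(\<integral>\<^sup>+ x. ennreal ((indicator D x * v x)\<^sup>2) \<partial>lborel) < \<infinity>"
    using \<kappa> by (auto simp: ennreal_mult_less_top)
  then have "integrable lborel (\<lambda>x. (indicator D x * v x)\<^sup>2)"
    by (auto simp: integrable_iff_bounded)
  then have vV0: "v \<in> V0_space j D"
    using v_int by (auto simp: V0_space_def V_space_iff v0)
  then have uV: "u \<in> V_space j D" unfolding u_def by (rule SV)
  have "ennreal (2 * Q u) \<le> ennreal (2 * Inf S)"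
    using u_energy nn_integral_increment_square[OF uV] by (simp add: Q_def)
  \<comment> \<open>\<open>ennreal\<close> sends negative numbers to 0, so comparing the real
    numbers needs this sign.\<close>
  moreover have "0 \<le> Inf S"
    using \<open>S \<noteq> {}\<close> Q_nonneg SV by (intro cInf_greatest) (auto simp: S_def)
  ultimately have Qu: "Q u \<le> Inf S" by (simp add: ennreal_le_iff)

  have "form_E j D u z = 0" if z: "z \<in> V0_space j D" for z
  proof -
    have zV: "z \<in> V_space j D" using z by (rule V0_space_subset)
    \<comment> \<open>First variation: \<open>u + t * z\<close> is a competitor for every
      \<open>t\<close>, and its excess energy is quadratic in \<open>t\<close>.\<close>
    have "0 \<le> t * (2 * form_E j D u z) + t\<^sup>2 * Q z" for t
    proof -
      have "Inf S \<le> Q (\<lambda>x. \<phi> x + 1 * (v x + t * z x))"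
        by (intro I_le V0_space_add_scale vV0 z)
      also have "(\<lambda>x. \<phi> x + 1 * (v x + t * z x)) = (\<lambda>x. u x + t * z x)"
        by (auto simp: u_def)
      finally show ?thesis
        using Qu unfolding Q_def form_E_expand[OF uV zV] by (simp add: mult_ac)
    qed
    then have "2 * form_E j D u z = 0" by (rule linear_coefficient_eq_0)
    then show ?thesis by simp
  qed
  moreover have "(\<lambda>x. u x - \<phi> x) = v" by (auto simp: u_def)
  ultimately show ?thesis
    using uV vV0 unfolding is_dirichlet_solution_def by (intro exI[of _ u]) auto
qed

section \<open>The weighted L^2 space on the exterior\<close>

text \<open>The kernel for jumps from the exterior into \<open>D\<close>. With the indicators built
  in, all integrals run over the whole space and Fubini applies directly.\<close>

definition ext_kernel :: "real^'n \<Rightarrow> real^'n \<Rightarrow> real" where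
  "ext_kernel x y = indicator (- D) x * indicator D y * ker x y"

lemma ext_kernel_nonneg [simp]: "0 \<le> ext_kernel x y"
  by (simp add: ext_kernel_def)

lemma ext_kernel_inside: "x \<in> D \<Longrightarrow> ext_kernel x y = 0"
  by (simp add: ext_kernel_def)

lemma ext_kernel_le_density_K: "ext_kernel x y \<le> density_K (x, y)"
  by (auto simp: ext_kernel_def density_K_def form_domain_def split: split_indicator)

lemma ext_kernel_measurable [measurable (raw)]:
  assumes [measurable]: "f \<in> borel_measurable M" "g \<in> borel_measurable M"
  shows "(\<lambda>x. ext_kernel (f x) (g x)) \<in> borel_measurable M"
  unfolding ext_kernel_def by measurable

text \<open>A real-valued version of the weight. Where the weight is infinite, the Bochner integral
  gives the default value 0.\<close>

definition ext_density :: "real^'n \<Rightarrow> real" where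
  "ext_density x = (LINT y|lborel. ext_kernel x y)"

lemma ext_density_nonneg [simp]: "0 \<le> ext_density x"
  by (simp add: ext_density_def)

lemma ext_density_measurable [measurable]: "ext_density \<in> borel_measurable borel"
  unfolding ext_density_def by measurable

lemma weight_indicator_eq:
  "weight j D x * indicator (- D) x = (\<integral>\<^sup>+ y. ennreal (ext_kernel x y) \<partial>lborel)"
proof (cases "x \<in> D")
  case False
  have "(\<integral>\<^sup>+ y\<in>D. ennreal (kernel j x y) \<partial>lborel) = (\<integral>\<^sup>+ y. ennreal (ext_kernel x y) \<partial>lborel)"
  proof (intro nn_integral_cong)
    fix y
    show "ennreal (kernel j x y) * indicator D y = ennreal (ext_kernel x y)"
    proof (cases "y \<in> D")
      case True
      then have "x \<noteq> y" using False by auto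
      then show ?thesis using True False by (simp add: ext_kernel_def kernel_eq_ker)
    qed (simp add: ext_kernel_def)
  qed
  then show ?thesis using False by (simp add: weight_def)
qed (simp add: ext_kernel_inside)

text \<open>An exterior point off the boundary has a ball of some radius \<open>r\<close> around it
  disjoint from \<open>D\<close>, so the kernel is at most \<open>j r\<close> on \<open>D\<close>,
  which has finite measure. The exceptional points lie on the boundary, a null set.\<close>

lemma ext_density_finite:
  "AE x in lborel. (\<integral>\<^sup>+ y. ennreal (ext_kernel x y) \<partial>lborel) = ennreal (ext_density x)"
proof -
  have "AE x in lborel. x \<notin> frontier D"
    using D_boundary by (intro AE_not_in) (auto simp: null_sets_def)
  then show ?thesis
  proof eventually_elim
    fix x assume x: "x \<notin> frontier D"
    have "(\<integral>\<^sup>+ y. ennreal (ext_kernel x y) \<partial>lborel) < \<infinity>"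
    proof (cases "x \<in> D")
      case False
      then have "x \<notin> closure D"
        using x D_open by (simp add: frontier_def interior_open)
      then obtain r where r: "r > 0" "ball x r \<subseteq> - closure D"
        using open_contains_ball[of "- closure D"] by auto
      have "ennreal (ext_kernel x y) \<le> ennreal (j r) * indicator D y" for y
      proof (cases "y \<in> D")
        case True
        then have "y \<notin> ball x r" using r closure_subset by blast
        then show ?thesis
          using True False r j_noninc[of r "norm (x - y)"]
          by (auto simp: ext_kernel_def ker_def dist_norm intro!: ennreal_leI)
      qed (simp add: ext_kernel_def)
      then have "(\<integral>\<^sup>+ y. ennreal (ext_kernel x y) \<partial>lborel) \<le> (\<integral>\<^sup>+ y. ennreal (j r) * indicator D y \<partial>lborel)"
        by (intro nn_integral_mono)
      also have "\<dots> = ennreal (j r) * emeasure lborel D"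
        by (intro nn_integral_cmult_indicator) simp
      also have "\<dots> < \<infinity>"
        using emeasure_bounded_finite[OF D_bounded] by (simp add: ennreal_mult_less_top less_top)
      finally show ?thesis .
    qed (simp add: ext_kernel_inside)
    then show "(\<integral>\<^sup>+ y. ennreal (ext_kernel x y) \<partial>lborel) = ennreal (ext_density x)"
      unfolding ext_density_def by (subst integral_eq_nn_integral) (auto simp: less_top)
  qed
qed

lemma ext_measure_eq: "ext_measure j D = density lborel (\<lambda>x. ennreal (ext_density x))"
  unfolding ext_measure_def weight_indicator_eq
  using ext_density_finite by (intro density_cong) auto

lemma sets_ext_measure [measurable_cong, simp]: "sets (ext_measure j D) = sets borel"
  by (simp add: ext_measure_def)

lemma nn_integral_ext_measure:
  assumes [measurable]: "f \<in> borel_measurable borel"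
  shows "(\<integral>\<^sup>+ x. f x \<partial>ext_measure j D) =
    (\<integral>\<^sup>+ x. \<integral>\<^sup>+ y. ennreal (ext_kernel x y) * f x \<partial>lborel \<partial>lborel)"
proof -
  have "(\<integral>\<^sup>+ x. f x \<partial>ext_measure j D) = (\<integral>\<^sup>+ x. (\<integral>\<^sup>+ y. ennreal (ext_kernel x y) \<partial>lborel) * f x \<partial>lborel)"
    unfolding ext_measure_def weight_indicator_eq by (intro nn_integral_density) auto
  then show ?thesis by (simp add: nn_integral_multc)
qed

lemma L2_inner_eq:
  assumes [measurable]: "f \<in> borel_measurable borel" "g \<in> borel_measurable borel"
  shows "L2_inner j D f g = (LINT x|lborel. ext_density x * (f x * g x))"
  unfolding L2_inner_def ext_measure_eq by (subst integral_density) auto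

lemma L2_ext_iff:
  "f \<in> L2_ext j D \<longleftrightarrow> f \<in> borel_measurable borel \<and> (\<forall>x\<in>D. f x = 0) \<and>
     integrable (ext_measure j D) (\<lambda>x. (f x)\<^sup>2)"
proof (cases "f \<in> borel_measurable borel")
  case [measurable]: True
  have "(\<lambda>x. (f x)\<^sup>2) \<in> borel_measurable (ext_measure j D)" by measurable
  then show ?thesis by (simp add: L2_ext_def integrable_iff_bounded)
qed (simp add: L2_ext_def)

lemma L2_ext_measurable: "f \<in> L2_ext j D \<Longrightarrow> f \<in> borel_measurable borel"
  by (simp add: L2_ext_def)

lemma L2_ext_integrable_mult:
  assumes f: "f \<in> L2_ext j D" and g: "g \<in> L2_ext j D"
  shows "integrable (ext_measure j D) (\<lambda>x. f x * g x)"
proof -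
  note [measurable] = L2_ext_measurable[OF f] L2_ext_measurable[OF g]
  show ?thesis
    using f g by (intro integrable_mult_of_squares) (auto simp: L2_ext_iff)
qed

lemma L2_ext_add_scale:
  assumes f: "f \<in> L2_ext j D" and g: "g \<in> L2_ext j D"
  shows "(\<lambda>x. f x + c * g x) \<in> L2_ext j D"
proof -
  note [measurable] = L2_ext_measurable[OF f] L2_ext_measurable[OF g]
  have "integrable (ext_measure j D) (\<lambda>x. (f x + c * g x)\<^sup>2)"
    using f g by (intro integrable_add_scale_square) (auto simp: L2_ext_iff)
  then show ?thesis using f g by (auto simp: L2_ext_iff)
qed

lemma L2_inner_commute: "L2_inner j D f g = L2_inner j D g f"
  by (simp add: L2_inner_def mult.commute)

lemma L2_inner_add_scale:
  assumes "f \<in> L2_ext j D" "g \<in> L2_ext j D" "h \<in> L2_ext j D"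
  shows "L2_inner j D (\<lambda>x. f x + c * g x) h = L2_inner j D f h + c * L2_inner j D g h"
  using L2_ext_integrable_mult[OF assms(1,3)] L2_ext_integrable_mult[OF assms(2,3)]
  by (simp add: L2_inner_def distrib_right mult.assoc)

lemma L2_inner_self_eq_0:
  assumes f: "f \<in> L2_ext j D" and "L2_inner j D f f = 0"
  shows "AE x in ext_measure j D. f x = 0"
proof -
  have "AE x in ext_measure j D. f x * f x = 0"
    using assms integral_nonneg_eq_0_iff_AE[OF L2_ext_integrable_mult[OF f f]]
    by (simp add: L2_inner_def)
  then show ?thesis by eventually_elim simp
qed

lemma L2_ext_eqI:
  assumes f: "f \<in> L2_ext j D" and g: "g \<in> L2_ext j D"
    and eq: "\<And>h. h \<in> L2_ext j D \<Longrightarrow> L2_inner j D f h = L2_inner j D g h"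
  shows "AE x in ext_measure j D. f x = g x"
proof -
  define h where "h = (\<lambda>x. f x + (-1) * g x)"
  have h: "h \<in> L2_ext j D" unfolding h_def by (rule L2_ext_add_scale[OF f g])
  have "L2_inner j D h h = 0"
    using L2_inner_add_scale[OF f g h, of "-1"] eq[OF h] by (simp add: h_def)
  from L2_inner_self_eq_0[OF h this] show ?thesis
    by eventually_elim (simp add: h_def)
qed

section \<open>The normal derivative and Green's formula\<close>

text \<open>The increment of \<open>g\<close> vanishes on D x D. The rest of the domain consists of
  D^c x D and D x D^c, which contribute the two mirror-image terms by symmetry of
  \<open>ker\<close>.\<close>

lemma density_K_increment_outer:
  assumes "\<And>x. x \<in> D \<Longrightarrow> g x = 0"
  shows "density_K (x, y) * (increment u (x, y) * increment g (x, y)) =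
    ext_kernel x y * ((u x - u y) * g x) + ext_kernel y x * ((u y - u x) * g y)"
  using assms[of x] assms[of y]
  by (cases "x \<in> D"; cases "y \<in> D")
    (auto simp: density_K_def ext_kernel_def form_domain_def increment_def ker_commute[of y x] algebra_simps)

text \<open>By Tonelli both mirror-image terms integrate to the squared norm of
  \<open>\<phi>\<close>. The computation stays in [0,\<infinity>], since integrability is what is
  being proved.\<close>

lemma L2_ext_subset_V_space:
  assumes \<phi>: "\<phi> \<in> L2_ext j D"
  shows "\<phi> \<in> V_space j D"
proof -
  note [measurable] = L2_ext_measurable[OF \<phi>]
  have \<phi>0: "\<And>x. x \<in> D \<Longrightarrow> \<phi> x = 0" using \<phi> by (simp add: L2_ext_def)
  have "ennreal (density_K (x, y)) * ennreal ((increment \<phi> (x, y))\<^sup>2) =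
      ennreal (ext_kernel x y) * ennreal ((\<phi> x)\<^sup>2) + ennreal (ext_kernel y x) * ennreal ((\<phi> y)\<^sup>2)" for x y
  proof -
    have "density_K (x, y) * (increment \<phi> (x, y))\<^sup>2 = ext_kernel x y * (\<phi> x)\<^sup>2 + ext_kernel y x * (\<phi> y)\<^sup>2"
      using density_K_increment_outer[where g = \<phi> and x = x and y = y and u = \<phi>, OF \<phi>0] \<phi>0[of x] \<phi>0[of y]
      by (auto simp: power2_eq_square ext_kernel_def split: split_indicator)
    then show ?thesis by (simp add: ennreal_mult[symmetric] ennreal_plus[symmetric] del: ennreal_plus)
  qed
  then have "(\<integral>\<^sup>+ p. ennreal ((increment \<phi> p)\<^sup>2) \<partial>jump_measure) =
      (\<integral>\<^sup>+ x. \<integral>\<^sup>+ y. ennreal (ext_kernel x y) * ennreal ((\<phi> x)\<^sup>2) + ennreal (ext_kernel y x) * ennreal ((\<phi> y)\<^sup>2)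
        \<partial>lborel \<partial>lborel)"
    by (subst nn_integral_jump) auto
  also have "\<dots> = (\<integral>\<^sup>+ x. \<integral>\<^sup>+ y. ennreal (ext_kernel x y) * ennreal ((\<phi> x)\<^sup>2) \<partial>lborel \<partial>lborel) +
      (\<integral>\<^sup>+ x. \<integral>\<^sup>+ y. ennreal (ext_kernel y x) * ennreal ((\<phi> y)\<^sup>2) \<partial>lborel \<partial>lborel)"
    by (simp add: nn_integral_add)
  also have "(\<integral>\<^sup>+ x. \<integral>\<^sup>+ y. ennreal (ext_kernel y x) * ennreal ((\<phi> y)\<^sup>2) \<partial>lborel \<partial>lborel) =
      (\<integral>\<^sup>+ y. \<integral>\<^sup>+ x. ennreal (ext_kernel y x) * ennreal ((\<phi> y)\<^sup>2) \<partial>lborel \<partial>lborel)"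
    by (rule lborel_pair.Fubini') measurable
  finally have "(\<integral>\<^sup>+ p. ennreal ((increment \<phi> p)\<^sup>2) \<partial>jump_measure) =
      (\<integral>\<^sup>+ x. ennreal ((\<phi> x)\<^sup>2) \<partial>ext_measure j D) + (\<integral>\<^sup>+ x. ennreal ((\<phi> x)\<^sup>2) \<partial>ext_measure j D)"
    by (simp add: nn_integral_ext_measure)
  also have "\<dots> < \<infinity>" using \<phi> by (simp add: L2_ext_def)
  finally have "integrable jump_measure (\<lambda>p. (increment \<phi> p)\<^sup>2)"
    by (simp add: integrable_iff_bounded)
  moreover have "(\<lambda>x. (indicator D x * \<phi> x)\<^sup>2) = (\<lambda>x. 0)"
    using \<phi>0 by (auto simp: fun_eq_iff split: split_indicator)
  ultimately show ?thesis
    by (simp add: V_space_iff L2_ext_measurable[OF \<phi>])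
qed

text \<open>The nonlocal normal derivative, normalized by the weight. At points where the weight is \<open>0\<close>
  the numerator is \<open>0\<close> as well, and the junk value of the quotient is harmless.\<close>

definition normal_derivative :: "(real^'n \<Rightarrow> real) \<Rightarrow> real^'n \<Rightarrow> real" where
  "normal_derivative u x = (LINT y|lborel. ext_kernel x y * (u x - u y)) / ext_density x"

lemma normal_derivative_measurable [measurable (raw)]:
  assumes [measurable]: "u \<in> borel_measurable borel"
  shows "normal_derivative u \<in> borel_measurable borel"
  unfolding normal_derivative_def by measurable

text \<open>Multiplying back is delicate only where \<open>ext_density\<close> is 0. Finiteness of
  the weight ensures that this 0 is genuine and not a default value, so the kernel vanishes for
  almost every \<open>y\<close>.\<close>

lemma density_times_normal_derivative:
  "AE x in lborel. ext_density x * normal_derivative u x = (LINT y|lborel. ext_kernel x y * (u x - u y))"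
  using ext_density_finite
proof eventually_elim
  fix x assume fin: "(\<integral>\<^sup>+ y. ennreal (ext_kernel x y) \<partial>lborel) = ennreal (ext_density x)"
  show "ext_density x * normal_derivative u x = (LINT y|lborel. ext_kernel x y * (u x - u y))"
  proof (cases "ext_density x = 0")
    case True
    with fin have "AE y in lborel. ext_kernel x y = 0"
      by (simp add: nn_integral_0_iff_AE)
    then have "(LINT y|lborel. ext_kernel x y * (u x - u y)) = 0"
      by (intro integral_eq_zero_AE) (auto elim: eventually_mono)
    then show ?thesis using True by simp
  qed (simp add: normal_derivative_def)
qed

text \<open>Cauchy-Schwarz with the kernel split as a product of two square roots bounds the square
  of the numerator by the weight times the right-hand side; one factor of the weight, nonzero and
  finite, then cancels.\<close>

lemma normal_derivative_square_le:
  assumes [measurable]: "u \<in> borel_measurable borel"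
  shows "AE x in lborel. ennreal (ext_density x) * ennreal ((normal_derivative u x)\<^sup>2)
    \<le> (\<integral>\<^sup>+ y. ennreal (ext_kernel x y * (u x - u y)\<^sup>2) \<partial>lborel)"
  using ext_density_finite density_times_normal_derivative[of u]
proof eventually_elim
  fix x
  assume fin: "(\<integral>\<^sup>+ y. ennreal (ext_kernel x y) \<partial>lborel) = ennreal (ext_density x)"
    and eq: "ext_density x * normal_derivative u x = (LINT y|lborel. ext_kernel x y * (u x - u y))"
  let ?m = "ext_density x" and ?f = "\<lambda>y. sqrt (ext_kernel x y)"
  show "ennreal ?m * ennreal ((normal_derivative u x)\<^sup>2)
      \<le> (\<integral>\<^sup>+ y. ennreal (ext_kernel x y * (u x - u y)\<^sup>2) \<partial>lborel)" (is "_ \<le> ?R")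
  proof (cases "?m = 0")
    case False
    have "ennreal \<bar>?m * normal_derivative u x\<bar> \<le> (\<integral>\<^sup>+ y. ennreal \<bar>ext_kernel x y * (u x - u y)\<bar> \<partial>lborel)"
      \<comment> \<open>If the integrand is not integrable, its Bochner integral is 0 and the bound
        is trivial.\<close>
      unfolding eq using integral_norm_bound_ennreal[of lborel "\<lambda>y. ext_kernel x y * (u x - u y)"]
      by (cases "integrable lborel (\<lambda>y. ext_kernel x y * (u x - u y))") (auto simp: not_integrable_integral_eq)
    also have "\<dots> = (\<integral>\<^sup>+ y. ennreal (?f y) * ennreal (?f y * \<bar>u x - u y\<bar>) \<partial>lborel)"
      by (intro nn_integral_cong) (simp add: ennreal_mult[symmetric] abs_mult mult.assoc[symmetric])
    finally have "(ennreal \<bar>?m * normal_derivative u x\<bar>)\<^sup>2 \<le> (\<dots>)\<^sup>2"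
      by (intro power_mono) auto
    also have "\<dots> \<le> (\<integral>\<^sup>+ y. (ennreal (?f y))\<^sup>2 \<partial>lborel) * (\<integral>\<^sup>+ y. (ennreal (?f y * \<bar>u x - u y\<bar>))\<^sup>2 \<partial>lborel)"
      by (intro Cauchy_Schwarz_nn_integral) auto
    also have "\<dots> = ennreal ?m * ?R"
      by (simp add: ennreal_power power_mult_distrib fin)
    also have "(ennreal \<bar>?m * normal_derivative u x\<bar>)\<^sup>2 = ennreal ?m * (ennreal ?m * ennreal ((normal_derivative u x)\<^sup>2))"
      by (simp add: ennreal_power power_mult_distrib ennreal_mult[symmetric] power2_eq_square mult_ac)
    finally show ?thesis
      using False ennreal_mult_le_mult_iff[of "ennreal ?m"] by simp
  qed simp
qed

lemma normal_derivative_bound: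
  assumes u: "u \<in> V_space j D"
  shows "(\<integral>\<^sup>+ x. ennreal ((normal_derivative u x)\<^sup>2) \<partial>ext_measure j D) \<le> ennreal (2 * form_E j D u u)"
proof -
  note [measurable] = V_space_measurable[OF u]
  have "(\<integral>\<^sup>+ x. ennreal ((normal_derivative u x)\<^sup>2) \<partial>ext_measure j D) =
      (\<integral>\<^sup>+ x. ennreal (ext_density x) * ennreal ((normal_derivative u x)\<^sup>2) \<partial>lborel)"
    unfolding ext_measure_eq by (intro nn_integral_density) auto
  also have "\<dots> \<le> (\<integral>\<^sup>+ x. \<integral>\<^sup>+ y. ennreal (ext_kernel x y * (u x - u y)\<^sup>2) \<partial>lborel \<partial>lborel)"
    by (intro nn_integral_mono_AE normal_derivative_square_le) simp
  also have "\<dots> \<le> (\<integral>\<^sup>+ x. \<integral>\<^sup>+ y. ennreal (density_K (x, y)) * ennreal ((increment u (x, y))\<^sup>2) \<partial>lborel \<partial>lborel)"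
    by (intro nn_integral_mono)
      (auto simp: increment_def ennreal_mult[symmetric] intro!: ennreal_leI mult_right_mono ext_kernel_le_density_K)
  also have "\<dots> = ennreal (2 * form_E j D u u)"
    unfolding nn_integral_increment_square[OF u, symmetric] by (subst nn_integral_jump) auto
  finally show ?thesis .
qed

lemma normal_derivative_L2_ext:
  assumes u: "u \<in> V_space j D"
  shows "normal_derivative u \<in> L2_ext j D"
  using normal_derivative_bound[OF u] V_space_measurable[OF u]
  by (auto simp: L2_ext_def normal_derivative_def[of u] ext_kernel_inside normal_derivative_measurable
      intro: le_less_trans)

lemma L2_inner_normal_derivative_self:
  assumes u: "u \<in> V_space j D"
  shows "L2_inner j D (normal_derivative u) (normal_derivative u) \<le> 2 * form_E j D u u"
proof -
  let ?N = "normal_derivative u"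
  have "ennreal (L2_inner j D ?N ?N) = (\<integral>\<^sup>+ x. ennreal ((?N x)\<^sup>2) \<partial>ext_measure j D)"
    using normal_derivative_L2_ext[OF u] unfolding L2_inner_def power2_eq_square[symmetric]
    by (subst nn_integral_eq_integral) (auto simp: L2_ext_iff)
  also have "\<dots> \<le> ennreal (2 * form_E j D u u)"
    by (rule normal_derivative_bound[OF u])
  finally show ?thesis
    using form_E_nonneg[OF V_space_measurable[OF u]] by (simp add: ennreal_le_iff)
qed

text \<open>A nonlocal Green formula for functions living on the exterior. The integrand
  \<open>G\<close> is \<open>F\<close> plus its mirror image; both have the same integral, which
  absorbs the factor 1/2, and the inner integral of \<open>F\<close> is the numerator of the normal
  derivative times \<open>g\<close>.\<close>

lemma green_formula:
  assumes u: "u \<in> V_space j D" and g: "g \<in> L2_ext j D"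
  shows "form_E j D u g = L2_inner j D (normal_derivative u) g"
proof -
  note [measurable] = V_space_measurable[OF u] L2_ext_measurable[OF g]
  have g0: "\<And>x. x \<in> D \<Longrightarrow> g x = 0" using g by (simp add: L2_ext_def)
  define F where "F p = ext_kernel (fst p) (snd p) * ((u (fst p) - u (snd p)) * g (fst p))" for p
  define G where "G p = density_K p * (increment u p * increment g p)" for p
  have [measurable]: "F \<in> borel_measurable (borel \<Otimes>\<^sub>M borel)" "G \<in> borel_measurable (borel \<Otimes>\<^sub>M borel)"
    unfolding F_def G_def by measurable
  have G_eq: "G p = F p + F (snd p, fst p)" for p
    using density_K_increment_outer[where g = g and x = "fst p" and y = "snd p" and u = u, OF g0] by (simp add: F_def G_def)
  \<comment> \<open>\<open>F\<close> is the restriction of \<open>G\<close> to D^c x D, so it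
    inherits the integrability that Fubini requires.\<close>
  have F_eq: "F p = indicator (- D) (fst p) * indicator D (snd p) * G p" for p
    unfolding G_eq by (auto simp: F_def ext_kernel_def split: split_indicator)
  have "integrable jump_measure (\<lambda>p. increment u p * increment g p)"
    by (intro increment_product_integrable u L2_ext_subset_V_space g)
  then have G_int: "integrable (lborel \<Otimes>\<^sub>M lborel) G"
    unfolding jump_measure_def G_def[abs_def] by (subst (asm) integrable_density) auto
  have F_int: "integrable (lborel \<Otimes>\<^sub>M lborel) F"
  proof (rule Bochner_Integration.integrable_bound[OF G_int])
    show "AE p in lborel \<Otimes>\<^sub>M lborel. norm (F p) \<le> norm (G p)"
      by (intro AE_I2) (auto simp: F_eq split: split_indicator)
  qed simp
  have F_swap: "integrable (lborel \<Otimes>\<^sub>M lborel) (\<lambda>p. F (snd p, fst p))"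
    "(LINT p|(lborel \<Otimes>\<^sub>M lborel). F (snd p, fst p)) = (LINT p|(lborel \<Otimes>\<^sub>M lborel). F p)"
    using lborel_pair.integrable_product_swap[OF F_int] lborel_pair.integral_product_swap[of F]
    by (simp_all add: case_prod_beta')
  have "form_E j D u g = 1/2 * (LINT p|(lborel \<Otimes>\<^sub>M lborel). G p)"
    unfolding form_E_eq[OF V_space_measurable[OF u] L2_ext_measurable[OF g]] jump_measure_def G_def
    by (subst integral_density) auto
  also have "(LINT p|(lborel \<Otimes>\<^sub>M lborel). G p) = 2 * (LINT p|(lborel \<Otimes>\<^sub>M lborel). F p)"
    unfolding G_eq using F_int F_swap by simp
  also have "(LINT p|(lborel \<Otimes>\<^sub>M lborel). F p) = (LINT x|lborel. LINT y|lborel. F (x, y))"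
    by (rule lborel_pair.integral_fst'[OF F_int, symmetric])
  also have "\<dots> = (LINT x|lborel. (LINT y|lborel. ext_kernel x y * (u x - u y)) * g x)"
    by (simp add: F_def mult.assoc[symmetric])
  also have "\<dots> = (LINT x|lborel. ext_density x * (normal_derivative u x * g x))"
  proof (rule integral_cong_AE)
    show "AE x in lborel. (LINT y|lborel. ext_kernel x y * (u x - u y)) * g x =
        ext_density x * (normal_derivative u x * g x)"
      using density_times_normal_derivative[of u]
      by eventually_elim (simp add: mult.assoc[symmetric])
  qed measurable
  also have "\<dots> = L2_inner j D (normal_derivative u) g"
    by (subst L2_inner_eq) auto
  finally show ?thesis by simp
qed

text \<open>A function that is 0 on \<open>D\<close> is its own normalized normal derivative
  wherever \<open>ext_density\<close> is nonzero, so Green's formula gives its squared norm.\<close>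

lemma form_E_L2_ext_self:
  assumes \<phi>: "\<phi> \<in> L2_ext j D"
  shows "form_E j D \<phi> \<phi> = L2_inner j D \<phi> \<phi>"
proof -
  note [measurable] = L2_ext_measurable[OF \<phi>]
  have "ext_density x * (normal_derivative \<phi> x * \<phi> x) = ext_density x * (\<phi> x * \<phi> x)" for x
  proof -
    have "ext_kernel x y * (\<phi> x - \<phi> y) = ext_kernel x y * \<phi> x" for y
      using \<phi> by (cases "y \<in> D") (auto simp: L2_ext_def ext_kernel_def)
    then have "normal_derivative \<phi> x = ext_density x * \<phi> x / ext_density x"
      by (simp only: normal_derivative_def ext_density_def Bochner_Integration.integral_mult_left_zero)
    then show ?thesis by (cases "ext_density x = 0") simp_all
  qed
  then show ?thesis
    unfolding green_formula[OF L2_ext_subset_V_space[OF \<phi>] \<phi>]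
    by (subst (1 2) L2_inner_eq) (auto simp only: normal_derivative_measurable L2_ext_measurable[OF \<phi>])
qed

section \<open>Solutions and the form C\<close>

lemma solution_V_space: "is_dirichlet_solution j D \<phi> u \<Longrightarrow> u \<in> V_space j D"
  by (simp add: is_dirichlet_solution_def)

lemma form_E_solutions:
  assumes u: "is_dirichlet_solution j D \<phi> u" and v: "is_dirichlet_solution j D \<psi> v"
    and \<psi>: "\<psi> \<in> V_space j D"
  shows "form_E j D u v = form_E j D u \<psi>"
proof -
  have z: "(\<lambda>x. v x - \<psi> x) \<in> V0_space j D" (is "?z \<in> _")
    using v by (simp add: is_dirichlet_solution_def)
  have "form_E j D u (\<lambda>x. \<psi> x + 1 * ?z x) = form_E j D u \<psi> + 1 * form_E j D u ?z"
    by (intro form_E_add_scale_right \<psi> V0_space_subset z solution_V_space[OF u])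
  then show ?thesis using u z by (simp add: is_dirichlet_solution_def)
qed

text \<open>Pythagoras: \<open>\<phi>\<close> is \<open>u\<close> minus a test function, to which
  \<open>u\<close> is orthogonal in the form.\<close>

lemma form_E_solution_le:
  assumes u: "is_dirichlet_solution j D \<phi> u" and \<phi>: "\<phi> \<in> V_space j D"
  shows "form_E j D u u \<le> form_E j D \<phi> \<phi>"
proof -
  have uV: "u \<in> V_space j D" using u by (rule solution_V_space)
  have z: "(\<lambda>x. u x - \<phi> x) \<in> V0_space j D" (is "?z \<in> _")
    using u by (simp add: is_dirichlet_solution_def)
  then have zV: "?z \<in> V_space j D" by (rule V0_space_subset)
  have "form_E j D (\<lambda>x. u x + (-1) * ?z x) (\<lambda>x. u x + (-1) * ?z x) = form_E j D u u + form_E j D ?z ?z"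
    unfolding form_E_expand[OF uV zV] using u z by (simp add: is_dirichlet_solution_def)
  then show ?thesis using form_E_nonneg[OF V_space_measurable[OF zV]] by simp
qed

lemma dirichlet_solution:
  "\<phi> \<in> L2_ext j D \<Longrightarrow> is_dirichlet_solution j D \<phi> (dirichlet_solution j D \<phi>)"
  unfolding dirichlet_solution_def
  using dirichlet_solution_exists[OF L2_ext_subset_V_space] by (rule someI_ex)

text \<open>Independence of the chosen representatives: a solution in one slot sees only the
  exterior data of the other, so the two slots can be exchanged one after the other, the first by
  symmetry.\<close>

lemma form_C_eq:
  assumes \<phi>: "\<phi> \<in> L2_ext j D" and \<psi>: "\<psi> \<in> L2_ext j D"
    and u: "is_dirichlet_solution j D \<phi> u" and v: "is_dirichlet_solution j D \<psi> v"
  shows "form_C j D \<phi> \<psi> = form_E j D u v"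
proof -
  note V = L2_ext_subset_V_space[OF \<phi>] L2_ext_subset_V_space[OF \<psi>]
  note U = dirichlet_solution[OF \<phi>] dirichlet_solution[OF \<psi>]
  have "form_C j D \<phi> \<psi> = form_E j D (dirichlet_solution j D \<phi>) v"
    unfolding form_C_def by (simp add: form_E_solutions[OF U(1) _ V(2)] U v)
  also have "\<dots> = form_E j D v (dirichlet_solution j D \<phi>)"
    by (rule form_E_commute)
  also have "\<dots> = form_E j D v u"
    by (simp add: form_E_solutions[OF v _ V(1)] U u)
  finally show ?thesis by (simp add: form_E_commute)
qed

lemma form_C_commute: "form_C j D \<phi> \<psi> = form_C j D \<psi> \<phi>"
  unfolding form_C_def by (rule form_E_commute)

section \<open>The Dirichlet-to-Neumann operator\<close>

definition dtn :: "(real^'n \<Rightarrow> real) \<Rightarrow> real^'n \<Rightarrow> real" where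
  "dtn \<phi> = normal_derivative (dirichlet_solution j D \<phi>)"

lemma dtn_L2_ext: "\<phi> \<in> L2_ext j D \<Longrightarrow> dtn \<phi> \<in> L2_ext j D"
  unfolding dtn_def by (intro normal_derivative_L2_ext solution_V_space[OF dirichlet_solution])

lemma L2_inner_dtn_eq_form_E:
  assumes \<phi>: "\<phi> \<in> L2_ext j D" and \<psi>: "\<psi> \<in> L2_ext j D"
  shows "L2_inner j D (dtn \<phi>) \<psi> = form_E j D (dirichlet_solution j D \<phi>) \<psi>"
  unfolding dtn_def
  by (rule green_formula[OF solution_V_space[OF dirichlet_solution[OF \<phi>]] \<psi>, symmetric])

lemma L2_inner_dtn:
  assumes \<phi>: "\<phi> \<in> L2_ext j D" and \<psi>: "\<psi> \<in> L2_ext j D"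
  shows "L2_inner j D (dtn \<phi>) \<psi> = form_C j D \<phi> \<psi>"
  unfolding L2_inner_dtn_eq_form_E[OF \<phi> \<psi>] form_C_def
  by (rule form_E_solutions[OF dirichlet_solution[OF \<phi>] dirichlet_solution[OF \<psi>]
      L2_ext_subset_V_space[OF \<psi>], symmetric])

lemma dtn_symmetric:
  assumes "\<phi> \<in> L2_ext j D" "\<psi> \<in> L2_ext j D"
  shows "L2_inner j D (dtn \<phi>) \<psi> = L2_inner j D (dtn \<psi>) \<phi>"
  using assms by (simp add: L2_inner_dtn form_C_commute)

text \<open>By symmetry, linearity can be read off in the second argument, so that no additivity
  of the chosen representatives of solutions is needed.\<close>

lemma dtn_add_scale:
  assumes \<phi>: "\<phi> \<in> L2_ext j D" and \<psi>: "\<psi> \<in> L2_ext j D"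
  shows "AE x in ext_measure j D. dtn (\<lambda>y. \<phi> y + c * \<psi> y) x = dtn \<phi> x + c * dtn \<psi> x"
proof (rule L2_ext_eqI)
  have s: "(\<lambda>y. \<phi> y + c * \<psi> y) \<in> L2_ext j D" by (rule L2_ext_add_scale[OF \<phi> \<psi>])
  show "dtn (\<lambda>y. \<phi> y + c * \<psi> y) \<in> L2_ext j D" by (rule dtn_L2_ext[OF s])
  show "(\<lambda>x. dtn \<phi> x + c * dtn \<psi> x) \<in> L2_ext j D"
    by (intro L2_ext_add_scale dtn_L2_ext \<phi> \<psi>)
  fix h assume h: "h \<in> L2_ext j D"
  have "L2_inner j D (dtn (\<lambda>y. \<phi> y + c * \<psi> y)) h = L2_inner j D (\<lambda>y. \<phi> y + c * \<psi> y) (dtn h)"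
    using dtn_symmetric[OF s h] by (simp only: L2_inner_commute[of "dtn h"])
  also have "\<dots> = L2_inner j D \<phi> (dtn h) + c * L2_inner j D \<psi> (dtn h)"
    by (intro L2_inner_add_scale \<phi> \<psi> dtn_L2_ext h)
  also have "\<dots> = L2_inner j D (dtn \<phi>) h + c * L2_inner j D (dtn \<psi>) h"
    using dtn_symmetric[OF \<phi> h] dtn_symmetric[OF \<psi> h] by (simp only: L2_inner_commute[of "dtn h"])
  also have "\<dots> = L2_inner j D (\<lambda>x. dtn \<phi> x + c * dtn \<psi> x) h"
    by (intro L2_inner_add_scale[symmetric] dtn_L2_ext \<phi> \<psi> h)
  finally show "L2_inner j D (dtn (\<lambda>y. \<phi> y + c * \<psi> y)) h = L2_inner j D (\<lambda>x. dtn \<phi> x + c * dtn \<psi> x) h" .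
qed

lemma L2_inner_dtn_self_le:
  assumes \<phi>: "\<phi> \<in> L2_ext j D"
  shows "L2_inner j D (dtn \<phi>) (dtn \<phi>) \<le> 2 * L2_inner j D \<phi> \<phi>"
  using L2_inner_normal_derivative_self[OF solution_V_space[OF dirichlet_solution[OF \<phi>]]]
    form_E_solution_le[OF dirichlet_solution[OF \<phi>] L2_ext_subset_V_space[OF \<phi>]]
    form_E_L2_ext_self[OF \<phi>]
  by (simp add: dtn_def)

text \<open>The difference of the data has norm 0, hence so does its image by boundedness; linearity
  then compares the two images.\<close>

lemma dtn_cong_AE:
  assumes \<phi>: "\<phi> \<in> L2_ext j D" and \<psi>: "\<psi> \<in> L2_ext j D"
    and eq: "AE x in ext_measure j D. \<phi> x = \<psi> x"
  shows "AE x in ext_measure j D. dtn \<phi> x = dtn \<psi> x"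
proof -
  define h where "h = (\<lambda>x. \<phi> x + (-1) * \<psi> x)"
  have h: "h \<in> L2_ext j D" unfolding h_def by (rule L2_ext_add_scale[OF \<phi> \<psi>])
  have "L2_inner j D h h = 0"
    unfolding L2_inner_def by (intro integral_eq_zero_AE) (use eq in \<open>eventually_elim, simp add: h_def\<close>)
  moreover have "0 \<le> L2_inner j D (dtn h) (dtn h)"
    by (simp add: L2_inner_def)
  ultimately have "L2_inner j D (dtn h) (dtn h) = 0"
    using L2_inner_dtn_self_le[OF h] by simp
  then have "AE x in ext_measure j D. dtn h x = 0"
    by (rule L2_inner_self_eq_0[OF dtn_L2_ext[OF h]])
  with dtn_add_scale[OF \<phi> \<psi>, of "-1"] show ?thesis
    by eventually_elim (simp add: h_def)
qed

lemma bounded_operator_dtn: "bounded_operator_L2 j D dtn"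
  unfolding bounded_operator_L2_def
proof (intro conjI ballI allI impI exI[of _ "sqrt 2"])
  fix \<phi> assume \<phi>: "\<phi> \<in> L2_ext j D"
  show "dtn \<phi> \<in> L2_ext j D"
    by (rule dtn_L2_ext[OF \<phi>])
  show "L2_norm j D (dtn \<phi>) \<le> sqrt 2 * L2_norm j D \<phi>"
    using L2_inner_dtn_self_le[OF \<phi>] by (simp add: L2_norm_def real_sqrt_mult[symmetric])
  \<comment> \<open>Homogeneity comes from the rule for sums by writing \<open>c * \<phi>\<close> as
    \<open>\<phi> + (c - 1) * \<phi>\<close>.\<close>
  show "AE x in ext_measure j D. dtn (\<lambda>y. c * \<phi> y) x = c * dtn \<phi> x" for c
    using dtn_add_scale[OF \<phi> \<phi>, of "c - 1"] by (simp add: left_diff_distrib)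
  fix \<psi> assume \<psi>: "\<psi> \<in> L2_ext j D"
  show "AE x in ext_measure j D. dtn (\<lambda>y. \<phi> y + \<psi> y) x = dtn \<phi> x + dtn \<psi> x"
    using dtn_add_scale[OF \<phi> \<psi>, of 1] by simp
  show "AE x in ext_measure j D. dtn \<phi> x = dtn \<psi> x" if "AE x in ext_measure j D. \<phi> x = \<psi> x"
    by (rule dtn_cong_AE[OF \<phi> \<psi> that])
qed

end

theorem proposition3p2:
  fixes j :: "real \<Rightarrow> real" and D :: "(real^'n) set"
  assumes dim: "CARD('n) \<ge> 2"
    and j_pos: "\<And>t. t > 0 \<Longrightarrow> j t > 0"
    and j_noninc: "\<And>s t. 0 < s \<Longrightarrow> s \<le> t \<Longrightarrow> j t \<le> j s"
    and j_levy: "(\<integral>\<^sup>+ x. ennreal (min 1 ((norm x)\<^sup>2) * j (norm x)) \<partial>(lborel :: (real^'n) measure)) < \<infinity>"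
    and D_open: "open D" and D_bounded: "bounded D"
    and D_boundary: "emeasure lborel (frontier D) = 0"
  shows "\<exists>N. bounded_operator_L2 j D N \<and>
    (\<forall>\<phi>\<in>L2_ext j D. \<forall>\<psi>\<in>L2_ext j D.
       L2_inner j D (N \<phi>) \<psi> = form_C j D \<phi> \<psi> \<and>
       (\<forall>u v. is_dirichlet_solution j D \<phi> u \<and> is_dirichlet_solution j D \<psi> v \<longrightarrow>
          form_C j D \<phi> \<psi> = form_E j D u v))"
proof -
  interpret jump_form j D
    by unfold_locales (fact j_pos j_noninc D_open D_bounded D_boundary)+
  show ?thesis
    by (intro exI[of _ dtn] conjI ballI allI impI bounded_operator_dtn L2_inner_dtn)
      (auto intro: form_C_eq)
qed

end
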